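(* Let $\mathcal{A}$ be the block matrix $$\mathcal{A}=\begin{bmatrix}(A_1\widehat{Y_2})^T\otimes I_{N_1} & I_{N_2}\otimes \widehat{Y_2}A_2\\ I_{N_1}\otimes \widehat{Y_3}A_1 & (A_2\widehat{Y_3})^T\otimes I_{N_2}\end{bmatrix}.$$ The system $$\begin{cases}X_1A_1\widehat{Y_2}+\widehat{Y_2}A_2X_4=A_1\widehat{Y_2}A_2,\\ \widehat{Y_3}A_1X_1+X_4A_2\widehat{Y_3}=A_2\widehat{Y_3}A_1\end{cases}$$ in the unknowns $X_1\in\mathbb{C}^{N_1\times N_1}$, $X_4\in\mathbb{C}^{N_2\times N_2}$ is consistent if and only if there exists an inner inverse $\mathcal{A}^-$ of $\mathcal{A}$ such that $$\mathcal{A}\mathcal{A}^-\begin{bmatrix}\operatorname{vec}(A_1\widehat{Y_2}A_2)\\ \operatorname{vec}(A_2\widehat{Y_3}A_1)\end{bmatrix}=\begin{bmatrix}\operatorname{vec}(A_1\widehat{Y_2}A_2)\\ \operatorname{vec}(A_2\widehat{Y_3}A_1)\end{bmatrix},$$ and in that case the solutions are given by $$\begin{bmatrix}\operatorname{vec}(X_1)\\ \operatorname{vec}(X_4)\end{bmatrix}=\mathcal{A}^-\begin{bmatrix}\operatorname{vec}(A_1\widehat{Y_2}A_2)\\ \operatorname{vec}(A_2\widehat{Y_3}A_1)\end{bmatrix}+(I-\mathcal{A}^-\mathcal{A})\begin{bmatrix}\operatorname{vec}(Z_1)\\ \operatorname{vec}(Z_4)\end{bmatrix},$$ for arbitrary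 $Z_1\in\mathbb{C}^{N_1\times N_1}$, $Z_4\in\mathbb{C}^{N_2\times N_2}$.
   Context: All matrices are complex. Let $n>2$ be an integer and $t\neq 0$ a complex number. $A_1\in\mathbb{C}^{N_1\times N_1}$ satisfies $A_1^2=0$, and $A_2\in\mathbb{C}^{N_2\times N_2}$ is invertible with $A_2^n=tA_2^2$ (these are the nilpotent and the invertible blocks of a matrix $A$ with $A^n=tA^2$ with respect to $\mathbb{C}^N=\mathcal{N}(A^2)\oplus\mathcal{R}(A^2)$, where $N_1=\dim\mathcal{N}(A^2)$, $N_2=\dim\mathcal{R}(A^2)$). Given $Y_2\in\mathbb{C}^{N_1\times N_2}$ and $Y_3\in\mathbb{C}^{N_2\times N_1}$, put $$\widehat{Y_2}=-(Y_2+A_1Y_2A_2^{-1})A_2^{-1},\qquad \widehat{Y_3}=A_2^{-1}(Y_3+A_2^{-1}Y_3A_1).$$ $\otimes$ is the Kronecker product, $S\otimes T=[s_{ij}T]$. $\operatorname{vec}(S)$ is the column vector obtained by stacking the columns of $S$ one on top of the other. An inner inverse of a matrix $S$ is any matrix $S^-$ with $SS^-S=S$. *)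

theory Defs
  imports Complex_Main "Jordan_Normal_Form.Gauss_Jordan_Elimination"
begin

definition kronecker :: "'a :: semiring_1 mat \<Rightarrow> 'a mat \<Rightarrow> 'a mat" (infixl \<open>\<otimes>\<^sub>k\<close> 72) where
  "S \<otimes>\<^sub>k T = mat (dim_row S * dim_row T) (dim_col S * dim_col T)
     (\<lambda>(i, j). S $$ (i div dim_row T, j div dim_col T) * T $$ (i mod dim_row T, j mod dim_col T))"

text \<open>Column stacking: the entry in row \<open>i\<close> and column \<open>j\<close> of \<open>S\<close> is found at position
  \<open>j * dim_row S + i\<close>.\<close>

definition vec_of_mat :: "'a mat \<Rightarrow> 'a vec" where
  "vec_of_mat S = vec (dim_row S * dim_col S) (\<lambda>k. S $$ (k mod dim_row S, k div dim_row S))"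

definition inner_inverse :: "'a :: semiring_1 mat \<Rightarrow> 'a mat \<Rightarrow> bool" where
  "inner_inverse S G \<longleftrightarrow> G \<in> carrier_mat (dim_col S) (dim_row S) \<and> S * G * S = S"

text \<open>\<^const>\<open>mat_inverse\<close> returns \<^const>\<open>None\<close> on singular matrices, so \<open>inv_mat\<close> is
  meaningful only for invertible arguments.\<close>

definition inv_mat :: "'a :: field mat \<Rightarrow> 'a mat" where
  "inv_mat A = the (mat_inverse A)"

lemma inv_mat:
  assumes A: "A \<in> carrier_mat n n" and inv: "invertible_mat A"
  shows "inv_mat A \<in> carrier_mat n n" "A * inv_mat A = 1\<^sub>m n" "inv_mat A * A = 1\<^sub>m n"
proof -
  obtain B where B: "A * B = 1\<^sub>m n" "B * A = 1\<^sub>m (dim_row B)"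
    using A inv unfolding invertible_mat_def inverts_mat_def by auto
  have "dim_col B = n" "dim_row B = n"
    using arg_cong[OF B(1), of dim_col] arg_cong[OF B(2), of dim_col] A by auto
  with B have "A \<in> Units (ring_mat TYPE('a) n ())"
    using A unfolding Units_def ring_mat_def by auto
  then obtain C where "mat_inverse A = Some C"
    using mat_inverse(1)[OF A, where b = "()"] by (cases "mat_inverse A") auto
  with mat_inverse(2)[OF A this]
  show "inv_mat A \<in> carrier_mat n n" "A * inv_mat A = 1\<^sub>m n" "inv_mat A * A = 1\<^sub>m n"
    by (auto simp: inv_mat_def)
qed

definition hat_Y2 :: "complex mat \<Rightarrow> complex mat \<Rightarrow> complex mat \<Rightarrow> complex mat" where
  "hat_Y2 A1 A2 Y2 = - (Y2 + A1 * Y2 * inv_mat A2) * inv_mat A2"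

definition hat_Y3 :: "complex mat \<Rightarrow> complex mat \<Rightarrow> complex mat \<Rightarrow> complex mat" where
  "hat_Y3 A1 A2 Y3 = inv_mat A2 * (Y3 + inv_mat A2 * Y3 * A1)"

end

theory Submission
  imports Defs
begin

text \<open>
  Column stacking is a linear bijection between matrices and vectors that turns \<open>X \<mapsto> A X B\<close> into
  multiplication by \<open>B\<^sup>T \<otimes> A\<close> (lemma \<open>vec_of_mat_mult_mult\<close>). Under it the pair of matrix equations
  becomes the single linear system \<open>M x = b\<close>, whose unknown \<open>x\<close> is \<open>vec X\<^sub>1\<close> stacked on \<open>vec X\<^sub>4\<close>.

  For a linear system and an inner inverse \<open>G\<close> of its matrix, Penrose's argument applies. The
  product \<open>M G\<close> acts as the identity on the column space of \<open>M\<close>, so \<open>M G b = b\<close> says exactly that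
  \<open>b\<close> lies in that space, and the columns of \<open>1 - G M\<close> span the kernel of \<open>M\<close>
  (lemmas \<open>consistent_iff_inner_inverse\<close> and \<open>solution_iff_inner_inverse\<close>).

  That a consistent system admits a suitable inner inverse holds because every matrix over a field
  has one (lemma \<open>inner_inverse_exists\<close>): Gauss-Jordan elimination reduces this to a matrix in
  reduced row echelon form, for which the transposed 0-1 matrix of the pivot positions is an inner
  inverse.
\<close>

section \<open>Inner inverses and linear systems\<close>

text \<open>The transposed pivot pattern \<open>G\<close> selects, for each nonzero row \<open>k\<close>, the pivot column of that
  row, which is a unit vector. Hence \<open>C G\<close> is diagonal, with \<open>1\<close> at the nonzero rows of \<open>C\<close> and
  \<open>0\<close> elsewhere, and so fixes \<open>C\<close>.\<close>

lemma row_echelon_form_inner_inverse_exists: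
  fixes C :: "'a :: field mat"
  assumes C: "C \<in> carrier_mat nr nc" and "row_echelon_form C"
  shows "\<exists>G. inner_inverse C G"
proof -
  from assms obtain f where f: "pivot_fun C f nc"
    unfolding row_echelon_form_def by auto
  have dim: "dim_row C = nr" using C by simp
  note p = pivot_funD[OF dim f]
  define G :: "'a mat" where "G = mat nc nr (\<lambda>(j, k). if j = f k then 1 else 0)"
  have G: "G \<in> carrier_mat nc nr" by (simp add: G_def)
  have CG: "(C * G) $$ (i, k) = (if i = k \<and> f k < nc then 1 else 0)"
    if "i < nr" "k < nr" for i k
  proof -
    have "(C * G) $$ (i, k) = (\<Sum>j\<in>{0..<nc}. C $$ (i, j) * (if j = f k then 1 else 0))"
      using C that by (simp add: G_def scalar_prod_def)
    also have "\<dots> = (if f k < nc then C $$ (i, f k) else 0)"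
      by (simp add: if_distrib cong: if_cong)
    also have "\<dots> = (if i = k \<and> f k < nc then 1 else 0)"
      using that p(4)[of k] p(5)[of k i] by auto
    finally show ?thesis .
  qed
  have "C * G * C = C"
  proof (rule eq_matI)
    fix i j assume "i < dim_row C" "j < dim_col C"
    hence i: "i < nr" and j: "j < nc" using C by auto
    have "(C * G * C) $$ (i, j) = (\<Sum>k\<in>{0..<nr}. (C * G) $$ (i, k) * C $$ (k, j))"
      using C G i j by (simp add: scalar_prod_def del: assoc_mult_mat)
    also have "\<dots> = (\<Sum>k\<in>{0..<nr}. if i = k then (if f i < nc then C $$ (i, j) else 0) else 0)"
      by (rule sum.cong) (use CG i in auto)
    also have "\<dots> = (if f i < nc then C $$ (i, j) else 0)"
      using i by simp
    also have "\<dots> = C $$ (i, j)"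
      using p(1)[OF i] p(2)[OF i, of j] j by auto
    finally show "(C * G * C) $$ (i, j) = C $$ (i, j)" .
  qed (use C G in auto)
  with C G show ?thesis by (auto simp: inner_inverse_def)
qed

text \<open>If \<open>C = P A\<close> with \<open>P\<close> invertible and \<open>K\<close> is an inner inverse of \<open>C\<close>, then \<open>K P\<close> is one of \<open>A\<close>.\<close>

lemma inner_inverse_exists:
  fixes A :: "'a :: field mat"
  shows "\<exists>G. inner_inverse A G"
proof -
  define nr nc where "nr = dim_row A" and "nc = dim_col A"
  have A: "A \<in> carrier_mat nr nc" by (simp add: nr_def nc_def)
  define C where "C = gauss_jordan_single A"
  note gj = gauss_jordan_single[OF A C_def[symmetric]]
  from gj(4) obtain P Q where CP: "C = P * A" and P: "P \<in> carrier_mat nr nr"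
    and Q: "Q \<in> carrier_mat nr nr" and QP: "Q * P = 1\<^sub>m nr" by auto
  from row_echelon_form_inner_inverse_exists[OF gj(2,3)] gj(2) obtain K
    where K: "K \<in> carrier_mat nc nr" and CKC: "C * K * C = C"
    by (auto simp: inner_inverse_def)
  have A_eq: "Q * C = A"
    unfolding CP using assoc_mult_mat[OF Q P A] QP A by simp
  have KP: "K * P \<in> carrier_mat nc nr" using K P by simp
  have "A * (K * P) * A = A * (K * C)"
    unfolding CP using assoc_mult_mat[OF A KP A] assoc_mult_mat[OF K P A] by simp
  also have "\<dots> = Q * (C * (K * C))"
    using assoc_mult_mat[OF Q gj(2), of "K * C" nc] K gj(2) A_eq by simp
  also have "\<dots> = Q * (C * K * C)"
    using assoc_mult_mat[OF gj(2) K gj(2)] by simp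
  also have "\<dots> = A" using CKC A_eq by simp
  finally show ?thesis using KP by (auto simp: inner_inverse_def nr_def nc_def)
qed

lemma inner_inverse_mult_vec:
  fixes A :: "'a :: comm_ring_1 mat"
  assumes A: "A \<in> carrier_mat m n" and "inner_inverse A G" and x: "x \<in> carrier_vec n"
  shows "A *\<^sub>v (G *\<^sub>v (A *\<^sub>v x)) = A *\<^sub>v x"
proof -
  from assms have G: "G \<in> carrier_mat n m" and AGA: "A * G * A = A"
    by (auto simp: inner_inverse_def)
  have "A *\<^sub>v (G *\<^sub>v (A *\<^sub>v x)) = (A * G * A) *\<^sub>v x"
    using A G x by (simp del: assoc_mult_mat add: assoc_mult_mat_vec[of _ m m _ n])
  thus ?thesis by (simp add: AGA)
qed

lemma consistent_iff_inner_inverse: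
  fixes A :: "'a :: field mat"
  assumes A: "A \<in> carrier_mat m n" and b: "b \<in> carrier_vec m"
  shows "(\<exists>x \<in> carrier_vec n. A *\<^sub>v x = b) \<longleftrightarrow> (\<exists>G. inner_inverse A G \<and> (A * G) *\<^sub>v b = b)"
proof
  assume "\<exists>x \<in> carrier_vec n. A *\<^sub>v x = b"
  then obtain x where x: "x \<in> carrier_vec n" and Ax: "A *\<^sub>v x = b" by blast
  obtain G where inv: "inner_inverse A G" using inner_inverse_exists by blast
  hence G: "G \<in> carrier_mat n m" using A by (auto simp: inner_inverse_def)
  have "(A * G) *\<^sub>v b = b"
    using inner_inverse_mult_vec[OF A inv x] A G b Ax by simp
  with inv show "\<exists>G. inner_inverse A G \<and> (A * G) *\<^sub>v b = b" by blast
next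
  assume "\<exists>G. inner_inverse A G \<and> (A * G) *\<^sub>v b = b"
  then obtain G where "inner_inverse A G" and AGb: "(A * G) *\<^sub>v b = b" by blast
  hence G: "G \<in> carrier_mat n m" using A by (auto simp: inner_inverse_def)
  hence "A *\<^sub>v (G *\<^sub>v b) = b" using AGb A b by simp
  moreover have "G *\<^sub>v b \<in> carrier_vec n" using G b by simp
  ultimately show "\<exists>x \<in> carrier_vec n. A *\<^sub>v x = b" by blast
qed

text \<open>Every solution \<open>x\<close> is of the parametrised form already with \<open>z = x\<close>, because \<open>G b = G A x\<close>.
  Conversely \<open>A\<close> annihilates \<open>z - G A z\<close> and maps \<open>G b\<close> to \<open>b\<close>.\<close>

lemma solution_iff_inner_inverse:
  fixes A :: "'a :: comm_ring_1 mat"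
  assumes A: "A \<in> carrier_mat m n" and b: "b \<in> carrier_vec m" and x: "x \<in> carrier_vec n"
    and inv: "inner_inverse A G" and AGb: "(A * G) *\<^sub>v b = b"
  shows "A *\<^sub>v x = b \<longleftrightarrow> (\<exists>z \<in> carrier_vec n. x = G *\<^sub>v b + (1\<^sub>m n - G * A) *\<^sub>v z)"
proof -
  from inv have G: "G \<in> carrier_mat n m" using A by (auto simp: inner_inverse_def)
  have proj: "(1\<^sub>m n - G * A) *\<^sub>v z = z - G *\<^sub>v (A *\<^sub>v z)" if "z \<in> carrier_vec n" for z
    using that A G by (simp add: minus_mult_distrib_mat_vec[of _ n n])
  show ?thesis
  proof
    assume Ax: "A *\<^sub>v x = b"
    have Gb: "G *\<^sub>v b \<in> carrier_vec n" using G b by simp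
    have "x = G *\<^sub>v b + (x - G *\<^sub>v b)" using x Gb by (intro eq_vecI) (auto simp del: dim_mult_mat_vec)
    thus "\<exists>z \<in> carrier_vec n. x = G *\<^sub>v b + (1\<^sub>m n - G * A) *\<^sub>v z"
      using x unfolding proj[OF x, unfolded Ax, symmetric] by blast
  next
    assume "\<exists>z \<in> carrier_vec n. x = G *\<^sub>v b + (1\<^sub>m n - G * A) *\<^sub>v z"
    then obtain z where z: "z \<in> carrier_vec n"
      and x_eq: "x = G *\<^sub>v b + (z - G *\<^sub>v (A *\<^sub>v z))" using proj by auto
    have car: "G *\<^sub>v b \<in> carrier_vec n" "G *\<^sub>v (A *\<^sub>v z) \<in> carrier_vec n"
      using A G b z by auto
    have "A *\<^sub>v x = A *\<^sub>v (G *\<^sub>v b) + (A *\<^sub>v z - A *\<^sub>v (G *\<^sub>v (A *\<^sub>v z)))"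
      unfolding x_eq using A car z
      by (simp add: mult_add_distrib_mat_vec[of _ m n] mult_minus_distrib_mat_vec[of _ m n])
    also have "A *\<^sub>v (G *\<^sub>v (A *\<^sub>v z)) = A *\<^sub>v z" by (rule inner_inverse_mult_vec[OF A inv z])
    also have "A *\<^sub>v (G *\<^sub>v b) = b" using AGb A G b by simp
    also have "b + (A *\<^sub>v z - A *\<^sub>v z) = b" using A b z by (intro eq_vecI) auto
    finally show "A *\<^sub>v x = b" .
  qed
qed

section \<open>Column stacking and the Kronecker product\<close>

lemma vec_of_mat_carrier [simp]:
  "S \<in> carrier_mat m n \<Longrightarrow> vec_of_mat S \<in> carrier_vec (m * n)"
  by (auto simp: vec_of_mat_def)

lemma kronecker_carrier [simp]:
  "S \<in> carrier_mat m n \<Longrightarrow> T \<in> carrier_mat p q \<Longrightarrow> S \<otimes>\<^sub>k T \<in> carrier_mat (m * p) (n * q)"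
  by (auto simp: kronecker_def)

lemma stacked_index_less:
  fixes i j m n :: nat
  assumes "i < m" "j < n"
  shows "j * m + i < m * n"
proof -
  have "j * m + i < Suc j * m" using assms by simp
  also have "\<dots> \<le> n * m" using assms by (intro mult_le_mono1) simp
  finally show ?thesis by (simp add: mult.commute)
qed

lemma unstacked_index_less:
  fixes k m n :: nat
  assumes "k < m * n"
  shows "k mod m < m" "k div m < n"
proof -
  from assms have "m \<noteq> 0" by (cases "m = 0") auto
  thus "k mod m < m" by simp
  show "k div m < n" using assms by (intro less_mult_imp_div_less) (simp add: mult.commute)
qed

lemma vec_of_mat_index:
  assumes "S \<in> carrier_mat m n" "i < m" "j < n"
  shows "vec_of_mat S $ (j * m + i) = S $$ (i, j)"
  using assms stacked_index_less[of i m j n] by (auto simp: vec_of_mat_def)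

lemma vec_of_mat_inject:
  assumes "S \<in> carrier_mat m n" "T \<in> carrier_mat m n"
  shows "vec_of_mat S = vec_of_mat T \<longleftrightarrow> S = T"
proof
  assume eq: "vec_of_mat S = vec_of_mat T"
  show "S = T"
  proof (rule eq_matI)
    fix i j assume "i < dim_row T" "j < dim_col T"
    hence "i < m" "j < n" using assms by auto
    thus "S $$ (i, j) = T $$ (i, j)"
      using eq vec_of_mat_index[OF assms(1)] vec_of_mat_index[OF assms(2)] by metis
  qed (use assms in auto)
qed simp

lemma vec_of_mat_surj:
  assumes "v \<in> carrier_vec (m * n)"
  obtains S where "S \<in> carrier_mat m n" "vec_of_mat S = v"
proof
  let ?S = "mat m n (\<lambda>(i, j). v $ (j * m + i))"
  show "?S \<in> carrier_mat m n" by simp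
  show "vec_of_mat ?S = v"
  proof (rule eq_vecI)
    fix k assume "k < dim_vec v"
    hence k: "k < m * n" using assms by simp
    thus "vec_of_mat ?S $ k = v $ k"
      using k unstacked_index_less[OF k] by (simp add: vec_of_mat_def)
  qed (use assms in \<open>simp add: vec_of_mat_def\<close>)
qed

text \<open>Both the unknowns and the free parameters of the matrix problem come in pairs. This transfers the
  quantifiers over them to the single vectors of Penrose's theorem.\<close>

lemma bex_vec_of_mat_append:
  "(\<exists>X \<in> carrier_mat m n. \<exists>Y \<in> carrier_mat p q. Q (vec_of_mat X @\<^sub>v vec_of_mat Y))
     \<longleftrightarrow> (\<exists>v \<in> carrier_vec (m * n + p * q). Q v)"
proof
  assume "\<exists>v \<in> carrier_vec (m * n + p * q). Q v"
  then obtain v where v: "v \<in> carrier_vec (m * n + p * q)" and Q: "Q v" by blast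
  obtain X where X: "X \<in> carrier_mat m n" "vec_of_mat X = vec_first v (m * n)"
    using vec_of_mat_surj[OF vec_first_carrier] by blast
  obtain Y where Y: "Y \<in> carrier_mat p q" "vec_of_mat Y = vec_last v (p * q)"
    using vec_of_mat_surj[OF vec_last_carrier] by blast
  have "vec_of_mat X @\<^sub>v vec_of_mat Y = v"
    using X(2) Y(2) vec_first_last_append[OF v] by simp
  with X(1) Y(1) Q
  show "\<exists>X \<in> carrier_mat m n. \<exists>Y \<in> carrier_mat p q. Q (vec_of_mat X @\<^sub>v vec_of_mat Y)" by blast
qed (use append_carrier_vec vec_of_mat_carrier in blast)

lemma sum_stacked_index:
  fixes f :: "nat \<Rightarrow> 'a :: comm_monoid_add"
  shows "(\<Sum>l<m * n. f l) = (\<Sum>j<n. \<Sum>i<m. f (j * m + i))"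
proof -
  have "(\<Sum>l<m * n. f l) = (\<Sum>j<n. sum f {j * m..<j * m + m})"
    by (simp add: sum.nat_group mult.commute)
  also have "\<dots> = (\<Sum>j<n. \<Sum>i<m. f (j * m + i))"
  proof (rule sum.cong)
    fix j
    show "sum f {j * m..<j * m + m} = (\<Sum>i<m. f (j * m + i))"
      using sum.shift_bounds_nat_ivl[of f 0 "j * m" m]
      by (simp add: add.commute lessThan_atLeast0)
  qed simp
  finally show ?thesis .
qed

text \<open>Entry \<open>(i, j)\<close> of \<open>A X B\<close> is \<open>\<Sum>r s. B\<^sub>r\<^sub>j A\<^sub>i\<^sub>s X\<^sub>s\<^sub>r\<close>. The pairs \<open>(r, s)\<close> enumerate the positions
  \<open>r * n + s\<close> of the stacked \<open>X\<close>, and \<open>B\<^sub>r\<^sub>j A\<^sub>i\<^sub>s\<close> is the corresponding entry of \<open>B\<^sup>T \<otimes> A\<close>.\<close>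

lemma vec_of_mat_mult_mult:
  fixes A X B :: "'a :: comm_semiring_1 mat"
  assumes A: "A \<in> carrier_mat m n" and X: "X \<in> carrier_mat n p" and B: "B \<in> carrier_mat p q"
  shows "vec_of_mat (A * X * B) = (B\<^sup>T \<otimes>\<^sub>k A) *\<^sub>v vec_of_mat X"
proof (rule eq_vecI)
  have car: "A * X * B \<in> carrier_mat m q" "B\<^sup>T \<otimes>\<^sub>k A \<in> carrier_mat (q * m) (p * n)"
    using A X B by auto
  show "dim_vec (vec_of_mat (A * X * B)) = dim_vec ((B\<^sup>T \<otimes>\<^sub>k A) *\<^sub>v vec_of_mat X)"
    using A X B car by (simp add: vec_of_mat_def mult.commute kronecker_def)
  fix k assume "k < dim_vec ((B\<^sup>T \<otimes>\<^sub>k A) *\<^sub>v vec_of_mat X)"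
  hence k: "k < m * q" using A B by (simp add: kronecker_def mult.commute)
  define i j where "i = k mod m" and "j = k div m"
  have i: "i < m" and j: "j < q" using unstacked_index_less[OF k] by (simp_all add: i_def j_def)
  have "vec_of_mat (A * X * B) $ k = (A * X * B) $$ (i, j)"
    using A X B k by (simp add: vec_of_mat_def i_def j_def)
  also have "\<dots> = (\<Sum>r<p. (\<Sum>s<n. A $$ (i, s) * X $$ (s, r)) * B $$ (r, j))"
    using A X B i j by (simp add: scalar_prod_def lessThan_atLeast0 del: assoc_mult_mat)
  also have "\<dots> = (\<Sum>r<p. \<Sum>s<n. B $$ (r, j) * A $$ (i, s) * X $$ (s, r))"
    by (simp add: sum_distrib_left sum_distrib_right mult_ac)
  also have "\<dots> = (\<Sum>r<p. \<Sum>s<n. (B\<^sup>T \<otimes>\<^sub>k A) $$ (k, r * n + s) * vec_of_mat X $ (r * n + s))"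
  proof (intro sum.cong refl)
    fix r s assume rs: "r \<in> {..<p}" "s \<in> {..<n}"
    have "r * n + s < p * n" using stacked_index_less[of s n r p] rs by (simp add: mult.commute)
    moreover have "k < q * m" using k by (simp add: mult.commute)
    ultimately have "(B\<^sup>T \<otimes>\<^sub>k A) $$ (k, r * n + s) = B $$ (r, j) * A $$ (i, s)"
      using A B rs j by (simp add: kronecker_def i_def[symmetric] j_def[symmetric])
    thus "B $$ (r, j) * A $$ (i, s) * X $$ (s, r)
        = (B\<^sup>T \<otimes>\<^sub>k A) $$ (k, r * n + s) * vec_of_mat X $ (r * n + s)"
      using vec_of_mat_index[OF X] rs by simp
  qed
  also have "\<dots> = (\<Sum>l<n * p. (B\<^sup>T \<otimes>\<^sub>k A) $$ (k, l) * vec_of_mat X $ l)"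
    by (simp add: sum_stacked_index)
  also have "\<dots> = ((B\<^sup>T \<otimes>\<^sub>k A) *\<^sub>v vec_of_mat X) $ k"
  proof -
    have "dim_vec (vec_of_mat X) = n * p" using X by (simp add: vec_of_mat_def)
    moreover have "k < dim_row (B\<^sup>T \<otimes>\<^sub>k A)" "dim_col (B\<^sup>T \<otimes>\<^sub>k A) = n * p"
      using car k by (auto simp: mult.commute)
    ultimately show ?thesis by (simp add: scalar_prod_def lessThan_atLeast0)
  qed
  finally show "vec_of_mat (A * X * B) $ k = ((B\<^sup>T \<otimes>\<^sub>k A) *\<^sub>v vec_of_mat X) $ k" .
qed

lemma vec_of_mat_mult_left:
  fixes A X :: "'a :: comm_semiring_1 mat"
  assumes "A \<in> carrier_mat m n" "X \<in> carrier_mat n p"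
  shows "vec_of_mat (A * X) = (1\<^sub>m p \<otimes>\<^sub>k A) *\<^sub>v vec_of_mat X"
  using vec_of_mat_mult_mult[OF assms one_carrier_mat] assms by simp

lemma vec_of_mat_mult_right:
  fixes X B :: "'a :: comm_semiring_1 mat"
  assumes "X \<in> carrier_mat n p" "B \<in> carrier_mat p q"
  shows "vec_of_mat (X * B) = (B\<^sup>T \<otimes>\<^sub>k 1\<^sub>m n) *\<^sub>v vec_of_mat X"
  using vec_of_mat_mult_mult[OF one_carrier_mat assms] assms by simp

lemma vec_of_mat_add:
  assumes "S \<in> carrier_mat m n" "T \<in> carrier_mat m n"
  shows "vec_of_mat (S + T) = vec_of_mat S + vec_of_mat T"
proof (rule eq_vecI)
  fix k assume "k < dim_vec (vec_of_mat S + vec_of_mat T)"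
  hence k: "k < m * n" using assms by (simp add: vec_of_mat_def)
  thus "vec_of_mat (S + T) $ k = (vec_of_mat S + vec_of_mat T) $ k"
    using assms k unstacked_index_less[OF k] by (simp add: vec_of_mat_def)
qed (use assms in \<open>simp add: vec_of_mat_def\<close>)

section \<open>The coupled matrix equations as one linear system\<close>

text \<open>\<open>X\<close> is multiplied from the right in the first equation and \<open>Y\<close> in the second. These two
  terms give the diagonal blocks of the form \<open>B\<^sup>T \<otimes> 1\<close>, while multiplication from the left gives
  the off-diagonal blocks \<open>1 \<otimes> C\<close>.\<close>

lemma coupled_sylvester_iff_linear_system:
  fixes B1 C1 F1 B2 C2 F2 X Y :: "'a :: comm_ring_1 mat"
  assumes B1: "B1 \<in> carrier_mat m n" and C1: "C1 \<in> carrier_mat m n"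
    and B2: "B2 \<in> carrier_mat n m" and C2: "C2 \<in> carrier_mat n m"
    and F1: "F1 \<in> carrier_mat m n" and F2: "F2 \<in> carrier_mat n m"
    and X: "X \<in> carrier_mat m m" and Y: "Y \<in> carrier_mat n n"
  shows "X * B1 + C1 * Y = F1 \<and> B2 * X + Y * C2 = F2 \<longleftrightarrow>
    four_block_mat (B1\<^sup>T \<otimes>\<^sub>k 1\<^sub>m m) (1\<^sub>m n \<otimes>\<^sub>k C1) (1\<^sub>m m \<otimes>\<^sub>k B2) (C2\<^sup>T \<otimes>\<^sub>k 1\<^sub>m n)
      *\<^sub>v (vec_of_mat X @\<^sub>v vec_of_mat Y) = vec_of_mat F1 @\<^sub>v vec_of_mat F2"
proof -
  have "four_block_mat (B1\<^sup>T \<otimes>\<^sub>k 1\<^sub>m m) (1\<^sub>m n \<otimes>\<^sub>k C1) (1\<^sub>m m \<otimes>\<^sub>k B2) (C2\<^sup>T \<otimes>\<^sub>k 1\<^sub>m n)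
      *\<^sub>v (vec_of_mat X @\<^sub>v vec_of_mat Y)
    = ((B1\<^sup>T \<otimes>\<^sub>k 1\<^sub>m m) *\<^sub>v vec_of_mat X + (1\<^sub>m n \<otimes>\<^sub>k C1) *\<^sub>v vec_of_mat Y)
      @\<^sub>v ((1\<^sub>m m \<otimes>\<^sub>k B2) *\<^sub>v vec_of_mat X + (C2\<^sup>T \<otimes>\<^sub>k 1\<^sub>m n) *\<^sub>v vec_of_mat Y)"
    by (rule four_block_mat_mult_vec[of _ "n * m" "m * m" _ "n * n" _ "m * n"])
      (use assms in \<open>auto intro!: kronecker_carrier\<close>)
  also have "\<dots> = vec_of_mat (X * B1 + C1 * Y) @\<^sub>v vec_of_mat (B2 * X + Y * C2)"
  proof -
    have "vec_of_mat (X * B1 + C1 * Y) = vec_of_mat (X * B1) + vec_of_mat (C1 * Y)"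
      by (rule vec_of_mat_add) (use assms in auto)
    moreover have "vec_of_mat (B2 * X + Y * C2) = vec_of_mat (B2 * X) + vec_of_mat (Y * C2)"
      by (rule vec_of_mat_add) (use assms in auto)
    ultimately show ?thesis
      by (simp add: vec_of_mat_mult_right[OF X B1] vec_of_mat_mult_left[OF C1 Y]
          vec_of_mat_mult_left[OF B2 X] vec_of_mat_mult_right[OF Y C2])
  qed
  also have "\<dots> = vec_of_mat F1 @\<^sub>v vec_of_mat F2 \<longleftrightarrow>
      vec_of_mat (X * B1 + C1 * Y) = vec_of_mat F1 \<and> vec_of_mat (B2 * X + Y * C2) = vec_of_mat F2"
    by (rule append_vec_eq[of _ "m * n"]) (use assms in \<open>auto intro!: vec_of_mat_carrier\<close>)
  also have "\<dots> \<longleftrightarrow> X * B1 + C1 * Y = F1 \<and> B2 * X + Y * C2 = F2"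
    using vec_of_mat_inject[of "X * B1 + C1 * Y" m n F1]
      vec_of_mat_inject[of "B2 * X + Y * C2" n m F2] assms by auto
  finally show ?thesis by blast
qed

theorem theorem2p3:
  fixes n N1 N2 :: nat and t :: complex
    and A1 A2 Y2 Y3 H2 H3 M :: "complex mat" and b :: "complex vec"
  assumes "n > 2" and "t \<noteq> 0"
    and "A1 \<in> carrier_mat N1 N1" and "A1 ^\<^sub>m 2 = 0\<^sub>m N1 N1"
    and "A2 \<in> carrier_mat N2 N2" and "invertible_mat A2"
    and "A2 ^\<^sub>m n = t \<cdot>\<^sub>m (A2 ^\<^sub>m 2)"
    and "Y2 \<in> carrier_mat N1 N2" and "Y3 \<in> carrier_mat N2 N1"
    and "H2 = hat_Y2 A1 A2 Y2" and "H3 = hat_Y3 A1 A2 Y3"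
    and "M = four_block_mat
               ((A1 * H2)\<^sup>T \<otimes>\<^sub>k 1\<^sub>m N1)  (1\<^sub>m N2 \<otimes>\<^sub>k (H2 * A2))
               (1\<^sub>m N1 \<otimes>\<^sub>k (H3 * A1))   ((A2 * H3)\<^sup>T \<otimes>\<^sub>k 1\<^sub>m N2)"
    and "b = vec_of_mat (A1 * H2 * A2) @\<^sub>v vec_of_mat (A2 * H3 * A1)"
  shows "((\<exists>X1 \<in> carrier_mat N1 N1. \<exists>X4 \<in> carrier_mat N2 N2.
            X1 * A1 * H2 + H2 * A2 * X4 = A1 * H2 * A2 \<and>
            H3 * A1 * X1 + X4 * A2 * H3 = A2 * H3 * A1)
         \<longleftrightarrow> (\<exists>G. inner_inverse M G \<and> (M * G) *\<^sub>v b = b))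
         \<and> (\<forall>G. inner_inverse M G \<and> (M * G) *\<^sub>v b = b \<longrightarrow>
           (\<forall>X1 \<in> carrier_mat N1 N1. \<forall>X4 \<in> carrier_mat N2 N2.
              (X1 * A1 * H2 + H2 * A2 * X4 = A1 * H2 * A2 \<and>
               H3 * A1 * X1 + X4 * A2 * H3 = A2 * H3 * A1)
              \<longleftrightarrow> (\<exists>Z1 \<in> carrier_mat N1 N1. \<exists>Z4 \<in> carrier_mat N2 N2.
                    vec_of_mat X1 @\<^sub>v vec_of_mat X4 =
                      G *\<^sub>v b
                      + (1\<^sub>m (N1 * N1 + N2 * N2) - G * M) *\<^sub>v (vec_of_mat Z1 @\<^sub>v vec_of_mat Z4))))"
proof -
  note A1 = assms(3) and A2 = assms(5) and Y2 = assms(8) and Y3 = assms(9)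
  note iA2 = inv_mat(1)[OF A2 assms(6)]
  have H2: "H2 \<in> carrier_mat N1 N2"
    unfolding assms(10) hat_Y2_def using A1 iA2 Y2 by auto
  have H3: "H3 \<in> carrier_mat N2 N1"
    unfolding assms(11) hat_Y3_def using A1 iA2 Y3 by auto
  have M: "M \<in> carrier_mat (N1 * N2 + N2 * N1) (N1 * N1 + N2 * N2)"
  proof -
    have "(A1 * H2)\<^sup>T \<otimes>\<^sub>k 1\<^sub>m N1 \<in> carrier_mat (N2 * N1) (N1 * N1)"
      "(A2 * H3)\<^sup>T \<otimes>\<^sub>k 1\<^sub>m N2 \<in> carrier_mat (N1 * N2) (N2 * N2)"
      using A1 A2 H2 H3 by (auto intro!: kronecker_carrier)
    thus ?thesis
      unfolding assms(12) using four_block_carrier_mat by (metis mult.commute)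
  qed
  have b: "b \<in> carrier_vec (N1 * N2 + N2 * N1)"
    unfolding assms(13) using A1 A2 H2 H3
    by (auto intro!: append_carrier_vec vec_of_mat_carrier)
  have system: "X1 * A1 * H2 + H2 * A2 * X4 = A1 * H2 * A2 \<and>
      H3 * A1 * X1 + X4 * A2 * H3 = A2 * H3 * A1
      \<longleftrightarrow> M *\<^sub>v (vec_of_mat X1 @\<^sub>v vec_of_mat X4) = b"
    if X1: "X1 \<in> carrier_mat N1 N1" and X4: "X4 \<in> carrier_mat N2 N2" for X1 X4
  proof -
    have "X1 * A1 * H2 = X1 * (A1 * H2)" "X4 * A2 * H3 = X4 * (A2 * H3)"
      using X1 X4 A1 A2 H2 H3 by auto
    thus ?thesis
      unfolding assms(12,13)
      using coupled_sylvester_iff_linear_system[of "A1 * H2" N1 N2 "H2 * A2" "H3 * A1" "A2 * H3"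
          "A1 * H2 * A2" "A2 * H3 * A1" X1 X4] X1 X4 A1 A2 H2 H3
      by simp
  qed
  have "(\<exists>X1 \<in> carrier_mat N1 N1. \<exists>X4 \<in> carrier_mat N2 N2.
            X1 * A1 * H2 + H2 * A2 * X4 = A1 * H2 * A2 \<and>
            H3 * A1 * X1 + X4 * A2 * H3 = A2 * H3 * A1)
      \<longleftrightarrow> (\<exists>X1 \<in> carrier_mat N1 N1. \<exists>X4 \<in> carrier_mat N2 N2.
            M *\<^sub>v (vec_of_mat X1 @\<^sub>v vec_of_mat X4) = b)"
    using system by blast
  also have "\<dots> \<longleftrightarrow> (\<exists>v \<in> carrier_vec (N1 * N1 + N2 * N2). M *\<^sub>v v = b)"
    by (rule bex_vec_of_mat_append)
  also have "\<dots> \<longleftrightarrow> (\<exists>G. inner_inverse M G \<and> (M * G) *\<^sub>v b = b)"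
    by (rule consistent_iff_inner_inverse[OF M b])
  finally have consistent: "(\<exists>X1 \<in> carrier_mat N1 N1. \<exists>X4 \<in> carrier_mat N2 N2.
            X1 * A1 * H2 + H2 * A2 * X4 = A1 * H2 * A2 \<and>
            H3 * A1 * X1 + X4 * A2 * H3 = A2 * H3 * A1)
      \<longleftrightarrow> (\<exists>G. inner_inverse M G \<and> (M * G) *\<^sub>v b = b)" .
  have solutions: "(X1 * A1 * H2 + H2 * A2 * X4 = A1 * H2 * A2 \<and>
        H3 * A1 * X1 + X4 * A2 * H3 = A2 * H3 * A1)
      \<longleftrightarrow> (\<exists>Z1 \<in> carrier_mat N1 N1. \<exists>Z4 \<in> carrier_mat N2 N2.
            vec_of_mat X1 @\<^sub>v vec_of_mat X4 =
              G *\<^sub>v b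
              + (1\<^sub>m (N1 * N1 + N2 * N2) - G * M) *\<^sub>v (vec_of_mat Z1 @\<^sub>v vec_of_mat Z4))"
    if G: "inner_inverse M G" "(M * G) *\<^sub>v b = b"
      and X1: "X1 \<in> carrier_mat N1 N1" and X4: "X4 \<in> carrier_mat N2 N2" for G X1 X4
  proof -
    have x: "vec_of_mat X1 @\<^sub>v vec_of_mat X4 \<in> carrier_vec (N1 * N1 + N2 * N2)"
      using X1 X4 by simp
    show ?thesis
      unfolding system[OF X1 X4] solution_iff_inner_inverse[OF M b x G]
      by (rule bex_vec_of_mat_append[symmetric])
  qed
  show ?thesis using consistent solutions by blast
qed

end
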